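(* Let $G$ be an abelian group and $\underline{g}=(g_1,\dots,g_m)\in G^m$. If $\mathcal{B}(\mathrm{supp}(\underline{g}))$ has a quadratic Gröbner system, then $\mathcal{B}(\underline{g})$ also has a quadratic Gröbner system, and hence the semigroup algebra $\mathbb{C}[\mathcal{B}(\underline{g})]$ is Koszul.
   Context: $G$ is written multiplicatively. $\mathcal{B}(\underline{g})=\{\alpha\in\mathbb{N}_0^m\mid\prod_i g_i^{\alpha_i}=1\}$ (submonoid of $(\mathbb{N}_0^m,+)$); $\mathrm{supp}(\underline{g})=\{g_1,\dots,g_m\}$, and for a finite $G_0\subseteq G$, $\mathcal{B}(G_0)=\{\alpha\in\mathbb{N}_0^{G_0}\mid\prod_{g\in G_0}g^{\alpha(g)}=1\}$. For a reduced affine monoid $T$ with (finite) atom set $\mathcal{A}(T)$, its defining congruence $\sim_T$ is the congruence on the free commutative monoid $\{x^{\alpha}\mid\alpha\in\mathbb{N}_0^{\mathcal{A}(T)}\}$ with $x^{\alpha}\sim_T x^{\gamma}$ iff $\sum\alpha(t)t=\sum\gamma(t)t$ in $T$. "$T$ has a quadratic Gröbner system" means: for some admissible total order $\prec$ (total order with $x\prec y\Rightarrow xz\prec yz$ and $1\prec x$ for $x\ne1$) there is a finite set $\Lambda$ of pairs with $x\sim_T y$, $y\prec x$ for all $(x,y)\in\Lambda$, every element not divisible by a first component of a pair of $\Lambda$ being $\prec$-minimal in its $\sim_T$-class, and $|\lambda|,|\mu|\le2$ for all $(x^{\lambda},x^{\mu})\in\Lambda$. *)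

theory Defs
  imports "HOL-Algebra.FiniteProduct" "HOL-Library.Multiset" "HOL-Library.Function_Algebras"
begin

text \<open>Exponent vectors in N_0^I are functions 'i => nat vanishing outside I.
  BG G g I is the monoid of alpha in N_0^I with prod_{i in I} (g i)^(alpha i) = 1.
  B(g_1..g_m) = BG G g {..<m};  B(G0) = BG G id G0.\<close>

definition BG :: "('a, 'b) monoid_scheme \<Rightarrow> ('i \<Rightarrow> 'a) \<Rightarrow> 'i set \<Rightarrow> ('i \<Rightarrow> nat) set" where
  "BG G g I = {\<alpha>. (\<forall>i. i \<notin> I \<longrightarrow> \<alpha> i = 0) \<and>
                   finprod G (\<lambda>i. g i [^]\<^bsub>G\<^esub> \<alpha> i) I = \<one>\<^bsub>G\<^esub>}"

definition atoms :: "('i \<Rightarrow> nat) set \<Rightarrow> ('i \<Rightarrow> nat) set" where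
  "atoms T = {a \<in> T. a \<noteq> 0 \<and> (\<forall>b c. b \<in> T \<longrightarrow> c \<in> T \<longrightarrow> a = b + c \<longrightarrow> b = 0 \<or> c = 0)}"

text \<open>Monomials x^lambda of the free commutative monoid on a set A are multisets over A
  (product = multiset sum, 1 = empty multiset, degree |lambda| = size).
  An admissible order is given by its strict part, a strict total order on these monomials.\<close>
definition admissible_order :: "'m set \<Rightarrow> ('m multiset \<Rightarrow> 'm multiset \<Rightarrow> bool) \<Rightarrow> bool" where
  "admissible_order A lt \<longleftrightarrow>
     (\<forall>x. set_mset x \<subseteq> A \<longrightarrow> \<not> lt x x) \<and>
     (\<forall>x y z. set_mset x \<subseteq> A \<longrightarrow> set_mset y \<subseteq> A \<longrightarrow> set_mset z \<subseteq> A \<longrightarrow>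
        lt x y \<longrightarrow> lt y z \<longrightarrow> lt x z) \<and>
     (\<forall>x y. set_mset x \<subseteq> A \<longrightarrow> set_mset y \<subseteq> A \<longrightarrow> x \<noteq> y \<longrightarrow> lt x y \<or> lt y x) \<and>
     (\<forall>x y z. set_mset x \<subseteq> A \<longrightarrow> set_mset y \<subseteq> A \<longrightarrow> set_mset z \<subseteq> A \<longrightarrow>
        lt x y \<longrightarrow> lt (x + z) (y + z)) \<and>
     (\<forall>x. set_mset x \<subseteq> A \<longrightarrow> x \<noteq> {#} \<longrightarrow> lt {#} x)"

definition def_cong :: "('i \<Rightarrow> nat) multiset \<Rightarrow> ('i \<Rightarrow> nat) multiset \<Rightarrow> bool" where
  "def_cong x y \<longleftrightarrow> sum_mset x = sum_mset y"

definition has_quadratic_groebner_system :: "('i \<Rightarrow> nat) set \<Rightarrow> bool" where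
  "has_quadratic_groebner_system T \<longleftrightarrow>
     (\<exists>lt \<Lambda>. admissible_order (atoms T) lt \<and> finite \<Lambda> \<and>
        (\<forall>(x, y) \<in> \<Lambda>. set_mset x \<subseteq> atoms T \<and> set_mset y \<subseteq> atoms T \<and>
            def_cong x y \<and> lt y x \<and> size x \<le> 2 \<and> size y \<le> 2) \<and>
        (\<forall>z. set_mset z \<subseteq> atoms T \<longrightarrow> (\<forall>(x, y) \<in> \<Lambda>. \<not> x \<subseteq># z) \<longrightarrow>
            (\<forall>w. set_mset w \<subseteq> atoms T \<longrightarrow> def_cong w z \<longrightarrow> w \<noteq> z \<longrightarrow> lt z w)))"

end

theory Submission
  imports Defs "HOL-Library.Ramsey" "HOL-Library.Multiset_Order" "HOL-Library.Product_Lexorder"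
begin

(*
  B(g) is built from B(supp g) in two kinds of steps. If g is injective on the index set K,
  relabelling coordinates is an isomorphism between B(g) and B(g(K)), and quadratic Groebner
  systems transfer along isomorphisms. Otherwise g x = g r for some r, x in K, and the monoid over K
  is {beta. merge_coord r x beta in B(K - {x})}: the coordinate r is split into r and x.

  For such a split T' = {beta. M beta in T}, where M adds coordinate j' to coordinate j, the atoms of
  T' are the atoms of T with their j-entry distributed over j and j'. Monomials of T' are ordered by
  the given order on their images under M and, within a fibre of M, by the multiset of keys
  (rank of the image atom, j-entry), larger first. The key-maximal monomial of a fibre is the only
  one admitting no quadratic exchange (an atom with an entry at j' next to an atom of smaller key with
  an entry at j), so the lifted quadratic rules of T together with these exchanges form a quadratic
  Groebner system of T'. Dickson's lemma keeps all atom sets finite.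
*)

section \<open>Dickson's lemma\<close>

lemma infinite_subset_mono_on_coords:
  fixes h :: "nat \<Rightarrow> 'i \<Rightarrow> nat"
  assumes "finite S" and "infinite Z"
  shows "\<exists>Y\<subseteq>Z. infinite Y \<and> (\<forall>i\<in>Y. \<forall>k\<in>Y. i < k \<longrightarrow> (\<forall>s\<in>S. h i s \<le> h k s))"
  using assms
proof (induction S arbitrary: Z rule: finite_induct)
  case empty
  then show ?case by blast
next
  case (insert s S)
  obtain Y0 where Y0: "Y0 \<subseteq> Z" "infinite Y0" "\<forall>i\<in>Y0. \<forall>k\<in>Y0. i < k \<longrightarrow> (\<forall>s\<in>S. h i s \<le> h k s)"
    using insert by blast
  define colour where "colour X = (if h (Min X) s \<le> h (Max X) s then 0 else 1 :: nat)" for X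
  have "\<forall>x\<in>Y0. \<forall>y\<in>Y0. x \<noteq> y \<longrightarrow> colour {x, y} < 2" by (simp add: colour_def)
  from Ramsey2[OF Y0(2) this] obtain Y t where Y: "Y \<subseteq> Y0" "infinite Y"
    and mono: "\<forall>x\<in>Y. \<forall>y\<in>Y. x \<noteq> y \<longrightarrow> colour {x, y} = t" by blast
  have colour_lt: "colour {i, k} = (if h i s \<le> h k s then 0 else 1)" if "i < k" for i k
    using that by (simp add: colour_def)
  show ?case
  proof (cases "t = 0")
    case True
    then have "\<forall>i\<in>Y. \<forall>k\<in>Y. i < k \<longrightarrow> h i s \<le> h k s"
      using mono colour_lt by (metis less_irrefl one_neq_zero)
    then have "\<forall>i\<in>Y. \<forall>k\<in>Y. i < k \<longrightarrow> (\<forall>s'\<in>insert s S. h i s' \<le> h k s')"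
      using Y(1) Y0(3) by blast
    then show ?thesis using Y Y0(1) by blast
  next
    case False
    then have decr: "h k s < h i s" if "i \<in> Y" "k \<in> Y" "i < k" for i k
      using that mono colour_lt by (metis less_irrefl not_le)
    obtain i where i: "i \<in> Y" using infinite_imp_nonempty[OF Y(2)] by blast
    have "inj_on (\<lambda>k. h k s) (Y - {..i})"
      using decr by (intro inj_onI) (metis DiffD1 linorder_neqE_nat less_irrefl)
    moreover have "(\<lambda>k. h k s) ` (Y - {..i}) \<subseteq> {..<h i s}"
      by (intro image_subsetI) (auto simp: not_le intro: decr[OF i])
    ultimately have "finite (Y - {..i})" by (rule inj_on_finite) simp
    then show ?thesis using Y(2) by simp
  qed
qed

lemma finite_antichain_of_finite_support:
  fixes X :: "('i \<Rightarrow> nat) set"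
  assumes "finite S" and supp: "\<And>x s. x \<in> X \<Longrightarrow> s \<notin> S \<Longrightarrow> x s = 0"
    and antichain: "\<And>x y. x \<in> X \<Longrightarrow> y \<in> X \<Longrightarrow> x \<le> y \<Longrightarrow> x = y"
  shows "finite X"
proof (rule ccontr)
  assume "infinite X"
  then obtain h :: "nat \<Rightarrow> _" where h: "inj h" "range h \<subseteq> X"
    using infinite_countable_subset by blast
  obtain Y where Y: "infinite Y" "\<forall>i\<in>Y. \<forall>k\<in>Y. i < k \<longrightarrow> (\<forall>s\<in>S. h i s \<le> h k s)"
    using infinite_subset_mono_on_coords[OF \<open>finite S\<close>, of UNIV h] by auto
  obtain i k where ik: "i \<in> Y" "k \<in> Y" "i < k"
    using Y(1) by (metis infinite_imp_nonempty ex_in_conv infinite_nat_iff_unbounded)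
  have "h i \<le> h k"
    unfolding le_fun_def using Y(2) ik supp h(2) by (metis range_subsetD zero_le)
  then show False using antichain h ik by (metis inj_eq less_irrefl range_subsetD)
qed

lemma atoms_antichain:
  assumes diff_closed: "\<And>a b. a \<in> T \<Longrightarrow> b \<in> T \<Longrightarrow> a \<le> b \<Longrightarrow> b - a \<in> T"
    and x: "x \<in> atoms T" and y: "y \<in> atoms T" and "x \<le> (y :: 'i \<Rightarrow> nat)"
  shows "x = y"
proof -
  have "y = x + (y - x)" using \<open>x \<le> y\<close> by (simp add: le_fun_def fun_eq_iff)
  moreover have "y - x \<in> T" using diff_closed x y \<open>x \<le> y\<close> by (simp add: atoms_def)
  ultimately have "y - x = 0" using x y by (auto simp: atoms_def)
  then show ?thesis using \<open>x \<le> y\<close> by (simp add: le_fun_def fun_eq_iff) (metis le_antisym)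
qed

section \<open>Quadratic Groebner systems\<close>

lemma sum_mset_image_additive:
  fixes \<phi> :: "'a::comm_monoid_add \<Rightarrow> 'b::cancel_comm_monoid_add"
  assumes "\<And>x y. \<phi> (x + y) = \<phi> x + \<phi> y"
  shows "sum_mset (image_mset \<phi> X) = \<phi> (sum_mset X)"
proof -
  have "\<phi> 0 = 0" using assms[of 0 0] by (metis add_cancel_right_right add_0)
  then show ?thesis using assms by (induction X) simp_all
qed

lemma admissible_order_refine:
  assumes adm: "admissible_order A lt"
    and f: "\<And>a. a \<in> A' \<Longrightarrow> f a \<in> A"
    and tb_irrefl: "\<And>x. \<not> tb x x"
    and tb_trans: "\<And>x y z. tb x y \<Longrightarrow> tb y z \<Longrightarrow> tb x z"
    and tb_add: "\<And>x y z. tb x y \<Longrightarrow> tb (x + z) (y + z)"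
    and tb_total: "\<And>x y. set_mset x \<subseteq> A' \<Longrightarrow> set_mset y \<subseteq> A' \<Longrightarrow> x \<noteq> y \<Longrightarrow>
      image_mset f x = image_mset f y \<Longrightarrow> tb x y \<or> tb y x"
  shows "admissible_order A'
    (\<lambda>x y. lt (image_mset f x) (image_mset f y) \<or> image_mset f x = image_mset f y \<and> tb x y)"
proof -
  let ?F = "image_mset f"
  have into: "set_mset (?F x) \<subseteq> A" if "set_mset x \<subseteq> A'" for x
    using that f by auto
  have irrefl: "\<And>x. set_mset x \<subseteq> A \<Longrightarrow> \<not> lt x x"
    and trans: "\<And>x y z. set_mset x \<subseteq> A \<Longrightarrow> set_mset y \<subseteq> A \<Longrightarrow> set_mset z \<subseteq> A \<Longrightarrow>
      lt x y \<Longrightarrow> lt y z \<Longrightarrow> lt x z"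
    and total: "\<And>x y. set_mset x \<subseteq> A \<Longrightarrow> set_mset y \<subseteq> A \<Longrightarrow> x \<noteq> y \<Longrightarrow> lt x y \<or> lt y x"
    and add: "\<And>x y z. set_mset x \<subseteq> A \<Longrightarrow> set_mset y \<subseteq> A \<Longrightarrow> set_mset z \<subseteq> A \<Longrightarrow>
      lt x y \<Longrightarrow> lt (x + z) (y + z)"
    and empty: "\<And>x. set_mset x \<subseteq> A \<Longrightarrow> x \<noteq> {#} \<Longrightarrow> lt {#} x"
    using adm unfolding admissible_order_def by blast+
  show ?thesis
    unfolding admissible_order_def
  proof (intro conjI allI impI)
    fix x assume "set_mset x \<subseteq> A'"
    then show "\<not> (lt (?F x) (?F x) \<or> ?F x = ?F x \<and> tb x x)"
      using irrefl into tb_irrefl by blast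
  next
    fix x y z assume "set_mset x \<subseteq> A'" "set_mset y \<subseteq> A'" "set_mset z \<subseteq> A'"
      and xy: "lt (?F x) (?F y) \<or> ?F x = ?F y \<and> tb x y"
      and yz: "lt (?F y) (?F z) \<or> ?F y = ?F z \<and> tb y z"
    then have "lt (?F x) (?F y) \<Longrightarrow> lt (?F y) (?F z) \<Longrightarrow> lt (?F x) (?F z)"
      using trans into by blast
    then show "lt (?F x) (?F z) \<or> ?F x = ?F z \<and> tb x z"
      using xy yz tb_trans by auto
  next
    fix x y assume xy: "set_mset x \<subseteq> A'" "set_mset y \<subseteq> A'" "x \<noteq> y"
    show "(lt (?F x) (?F y) \<or> ?F x = ?F y \<and> tb x y) \<or> (lt (?F y) (?F x) \<or> ?F y = ?F x \<and> tb y x)"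
    proof (cases "?F x = ?F y")
      case True
      then show ?thesis using tb_total[OF xy] by auto
    next
      case False
      then show ?thesis using total[OF into into] xy by blast
    qed
  next
    fix x y z assume "set_mset x \<subseteq> A'" "set_mset y \<subseteq> A'" "set_mset z \<subseteq> A'"
      and "lt (?F x) (?F y) \<or> ?F x = ?F y \<and> tb x y"
    moreover from this have "lt (?F x) (?F y) \<Longrightarrow> lt (?F x + ?F z) (?F y + ?F z)"
      using add into by blast
    ultimately show "lt (?F (x + z)) (?F (y + z)) \<or> ?F (x + z) = ?F (y + z) \<and> tb (x + z) (y + z)"
      using tb_add by auto
  next
    fix x assume "set_mset x \<subseteq> A'" "x \<noteq> {#}"
    then show "lt (?F {#}) (?F x) \<or> ?F {#} = ?F x \<and> tb {#} x"
      using empty into by simp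
  qed
qed

lemma image_mset_inj_on_eq:
  assumes "inj_on f A" and "set_mset x \<subseteq> A" and "set_mset y \<subseteq> A"
    and "image_mset f x = image_mset f y"
  shows "x = y"
  using assms multiset.inj_map_strong[of x y f f] by (meson inj_on_eq_iff subsetD)

lemma admissible_order_pullback:
  assumes "admissible_order A lt" and "\<And>a. a \<in> A' \<Longrightarrow> f a \<in> A" and "inj_on f A'"
  shows "admissible_order A' (\<lambda>x y. lt (image_mset f x) (image_mset f y))"
proof -
  have "admissible_order A'
    (\<lambda>x y. lt (image_mset f x) (image_mset f y) \<or> image_mset f x = image_mset f y \<and> False)"
  proof (rule admissible_order_refine[OF assms(1,2), where tb = "\<lambda>_ _. False"])
    show "False \<or> False" if "set_mset x \<subseteq> A'" "set_mset y \<subseteq> A'" "x \<noteq> y"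
      and "image_mset f x = image_mset f y" for x y
      using image_mset_inj_on_eq[OF assms(3)] that by blast
  qed auto
  then show ?thesis by simp
qed

definition quadratic_normal ::
    "('i \<Rightarrow> nat) set \<Rightarrow> (('i \<Rightarrow> nat) multiset \<Rightarrow> ('i \<Rightarrow> nat) multiset \<Rightarrow> bool) \<Rightarrow>
     ('i \<Rightarrow> nat) multiset \<Rightarrow> bool" where
  "quadratic_normal A lt z \<longleftrightarrow>
     (\<forall>x y. x \<subseteq># z \<longrightarrow> set_mset y \<subseteq> A \<longrightarrow> size x \<le> 2 \<longrightarrow> size y \<le> 2 \<longrightarrow> def_cong x y \<longrightarrow> \<not> lt y x)"

lemma finite_multisets_of_size_le:
  assumes "finite A"
  shows "finite {x. set_mset x \<subseteq> A \<and> size x \<le> n}"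
proof -
  have "{x. set_mset x \<subseteq> A \<and> size x \<le> n} = (\<Union>k\<le>n. multisets_of_size A k)"
    by (auto simp: multisets_of_size_def)
  then show ?thesis using assms by auto
qed

lemma has_quadratic_groebner_systemI:
  assumes "finite (atoms T)" and adm: "admissible_order (atoms T) lt"
    and minimal: "\<And>z w. set_mset z \<subseteq> atoms T \<Longrightarrow> set_mset w \<subseteq> atoms T \<Longrightarrow>
      quadratic_normal (atoms T) lt z \<Longrightarrow> def_cong w z \<Longrightarrow> w \<noteq> z \<Longrightarrow> lt z w"
  shows "has_quadratic_groebner_system T"
proof -
  define Q where "Q = {x. set_mset x \<subseteq> atoms T \<and> size x \<le> 2}"
  define \<Lambda> where "\<Lambda> = {(x, y). x \<in> Q \<and> y \<in> Q \<and> def_cong x y \<and> lt y x}"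
  have "finite Q" using finite_multisets_of_size_le[OF \<open>finite (atoms T)\<close>] by (simp add: Q_def)
  moreover have "\<Lambda> \<subseteq> Q \<times> Q" by (auto simp: \<Lambda>_def)
  ultimately have "finite \<Lambda>" by (meson finite_SigmaI finite_subset)
  moreover have "quadratic_normal (atoms T) lt z"
    if z: "set_mset z \<subseteq> atoms T" and normal: "\<forall>(x, y) \<in> \<Lambda>. \<not> x \<subseteq># z" for z
    unfolding quadratic_normal_def
  proof (intro allI impI notI)
    fix x y assume "x \<subseteq># z" "set_mset y \<subseteq> atoms T" "size x \<le> 2" "size y \<le> 2"
      "def_cong x y" "lt y x"
    then have "(x, y) \<in> \<Lambda>" using z by (auto simp: \<Lambda>_def Q_def dest: mset_subset_eqD)
    then show False using normal \<open>x \<subseteq># z\<close> by blast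
  qed
  ultimately show ?thesis
    unfolding has_quadratic_groebner_system_def using adm minimal
    by (intro exI[of _ lt] exI[of _ \<Lambda>] conjI) (auto simp: \<Lambda>_def Q_def)
qed

lemma has_quadratic_groebner_system_transfer:
  assumes qgs: "has_quadratic_groebner_system T" and "finite (atoms T)"
    and bij: "bij_betw h (atoms T) (atoms T')"
    and cong: "\<And>x y. set_mset x \<subseteq> atoms T \<Longrightarrow> set_mset y \<subseteq> atoms T \<Longrightarrow>
      def_cong (image_mset h x) (image_mset h y) \<longleftrightarrow> def_cong x y"
  shows "has_quadratic_groebner_system T'"
proof -
  obtain lt \<Lambda> where adm: "admissible_order (atoms T) lt"
    and \<Lambda>: "\<forall>(x, y) \<in> \<Lambda>. set_mset x \<subseteq> atoms T \<and> set_mset y \<subseteq> atoms T \<and>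
      def_cong x y \<and> lt y x \<and> size x \<le> 2 \<and> size y \<le> 2"
    and groebner: "\<forall>z. set_mset z \<subseteq> atoms T \<longrightarrow> (\<forall>(x, y) \<in> \<Lambda>. \<not> x \<subseteq># z) \<longrightarrow>
      (\<forall>w. set_mset w \<subseteq> atoms T \<longrightarrow> def_cong w z \<longrightarrow> w \<noteq> z \<longrightarrow> lt z w)"
    using qgs unfolding has_quadratic_groebner_system_def by blast
  define \<psi> where "\<psi> = inv_into (atoms T) h"
  define H \<Psi> where "H = image_mset h" and "\<Psi> = image_mset \<psi>"
  have h_into: "\<And>a. a \<in> atoms T \<Longrightarrow> h a \<in> atoms T'" and \<psi>_into: "\<And>a. a \<in> atoms T' \<Longrightarrow> \<psi> a \<in> atoms T"
    and \<psi>_h: "\<And>a. a \<in> atoms T \<Longrightarrow> \<psi> (h a) = a" and h_\<psi>: "\<And>a. a \<in> atoms T' \<Longrightarrow> h (\<psi> a) = a"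
    using bij by (auto simp: \<psi>_def bij_betw_def inv_into_into f_inv_into_f)
  have \<Psi>_H: "\<Psi> (H x) = x" if "set_mset x \<subseteq> atoms T" for x
    using that \<psi>_h by (induction x) (auto simp: H_def \<Psi>_def)
  have H_\<Psi>: "H (\<Psi> x) = x" if "set_mset x \<subseteq> atoms T'" for x
    using that h_\<psi> by (induction x) (auto simp: H_def \<Psi>_def)
  have \<Psi>_into: "set_mset (\<Psi> x) \<subseteq> atoms T" if "set_mset x \<subseteq> atoms T'" for x
    using that \<psi>_into by (auto simp: \<Psi>_def)
  show ?thesis
  proof (rule has_quadratic_groebner_systemI[where lt = "\<lambda>x y. lt (\<Psi> x) (\<Psi> y)"])
    show "finite (atoms T')" using bij_betw_finite[OF bij] \<open>finite (atoms T)\<close> by blast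
    show "admissible_order (atoms T') (\<lambda>x y. lt (\<Psi> x) (\<Psi> y))"
      unfolding \<Psi>_def using adm \<psi>_into
    proof (rule admissible_order_pullback)
      show "inj_on \<psi> (atoms T')"
        using bij unfolding \<psi>_def bij_betw_def by (simp add: inj_on_inv_into)
    qed
    fix z' w' assume z': "set_mset z' \<subseteq> atoms T'" and w': "set_mset w' \<subseteq> atoms T'"
      and normal: "quadratic_normal (atoms T') (\<lambda>x y. lt (\<Psi> x) (\<Psi> y)) z'"
      and "def_cong w' z'" and "w' \<noteq> z'"
    have "\<forall>(x, y) \<in> \<Lambda>. \<not> x \<subseteq># \<Psi> z'"
    proof (clarify)
      fix x y assume "(x, y) \<in> \<Lambda>" and "x \<subseteq># \<Psi> z'"
      then have x: "set_mset x \<subseteq> atoms T" and y: "set_mset y \<subseteq> atoms T"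
        and "def_cong x y" "lt y x" "size x \<le> 2" "size y \<le> 2" using \<Lambda> by auto
      moreover have "H x \<subseteq># z'"
        using image_mset_subseteq_mono[OF \<open>x \<subseteq># \<Psi> z'\<close>, of h] H_\<Psi>[OF z'] by (simp add: H_def)
      moreover have "set_mset (H y) \<subseteq> atoms T'" using y h_into by (auto simp: H_def)
      moreover have "def_cong (H x) (H y)" using cong[OF x y] \<open>def_cong x y\<close> by (simp add: H_def)
      moreover have "lt (\<Psi> (H y)) (\<Psi> (H x))" using \<Psi>_H[OF x] \<Psi>_H[OF y] \<open>lt y x\<close> by simp
      ultimately show False
        using normal[unfolded quadratic_normal_def, rule_format, of "H x" "H y"] by (simp add: H_def)
    qed
    moreover have "def_cong (\<Psi> w') (\<Psi> z')"
      using cong[OF \<Psi>_into[OF w'] \<Psi>_into[OF z']] H_\<Psi>[OF w'] H_\<Psi>[OF z'] \<open>def_cong w' z'\<close>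
      by (simp add: H_def)
    moreover have "\<Psi> w' \<noteq> \<Psi> z'" using H_\<Psi>[OF w'] H_\<Psi>[OF z'] \<open>w' \<noteq> z'\<close> by metis
    ultimately show "lt (\<Psi> z') (\<Psi> w')"
      using groebner[rule_format, OF \<Psi>_into[OF z'] _ \<Psi>_into[OF w']] by blast
  qed
qed

context
  fixes D :: "('i \<Rightarrow> nat) set" and \<phi> :: "('i \<Rightarrow> nat) \<Rightarrow> ('j \<Rightarrow> nat)"
  assumes zero_in: "0 \<in> D" and add_closed: "\<And>x y. x \<in> D \<Longrightarrow> y \<in> D \<Longrightarrow> x + y \<in> D"
    and inj: "inj_on \<phi> D" and additive: "\<And>x y. \<phi> (x + y) = \<phi> x + \<phi> y"
begin

lemma additive_eq_0_iff: "x \<in> D \<Longrightarrow> \<phi> x = 0 \<longleftrightarrow> x = 0"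
  using inj zero_in additive[of 0 0] by (metis add_cancel_right_right inj_on_eq_iff)

lemma atoms_image_additive:
  assumes "T \<subseteq> D"
  shows "atoms (\<phi> ` T) = \<phi> ` atoms T"
proof (intro equalityI subsetI)
  fix a' assume a': "a' \<in> atoms (\<phi> ` T)"
  then obtain a where a: "a \<in> T" "a' = \<phi> a" by (auto simp: atoms_def)
  have irreducible: "\<forall>b'\<in>\<phi> ` T. \<forall>c'\<in>\<phi> ` T. a' = b' + c' \<longrightarrow> b' = 0 \<or> c' = 0"
    using a' by (auto simp: atoms_def)
  have "b = 0 \<or> c = 0" if "b \<in> T" "c \<in> T" "a = b + c" for b c
    using irreducible that a additive additive_eq_0_iff assms by (metis imageI subsetD)
  then show "a' \<in> \<phi> ` atoms T"
    using a a' assms additive_eq_0_iff by (auto simp: atoms_def)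
next
  fix a' assume "a' \<in> \<phi> ` atoms T"
  then obtain a where a: "a \<in> atoms T" "a' = \<phi> a" by auto
  have "a = b + c" if "b \<in> T" "c \<in> T" "\<phi> a = \<phi> b + \<phi> c" for b c
  proof -
    have "\<phi> a = \<phi> (b + c)" using that(3) additive by simp
    moreover have "a \<in> D" "b + c \<in> D" using that a(1) assms add_closed by (auto simp: atoms_def subset_iff)
    ultimately show ?thesis using inj by (simp add: inj_on_eq_iff)
  qed
  then have "\<forall>b'\<in>\<phi> ` T. \<forall>c'\<in>\<phi> ` T. a' = b' + c' \<longrightarrow> b' = 0 \<or> c' = 0"
    using a additive[of 0 0] by (auto simp: atoms_def)
  then show "a' \<in> atoms (\<phi> ` T)"
    using a assms additive_eq_0_iff by (auto simp: atoms_def subset_iff)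
qed

lemma has_quadratic_groebner_system_image:
  assumes "has_quadratic_groebner_system T" and "finite (atoms T)" and "T \<subseteq> D"
  shows "has_quadratic_groebner_system (\<phi> ` T)"
proof (rule has_quadratic_groebner_system_transfer[OF assms(1,2)])
  have atoms_D: "atoms T \<subseteq> D" using assms(3) by (auto simp: atoms_def)
  show "bij_betw \<phi> (atoms T) (atoms (\<phi> ` T))"
    unfolding atoms_image_additive[OF assms(3)] using inj_on_subset[OF inj atoms_D]
    by (rule inj_on_imp_bij_betw)
  have sum_D: "sum_mset x \<in> D" if "set_mset x \<subseteq> atoms T" for x
    using that atoms_D by (induction x) (auto simp: zero_in add_closed)
  show "def_cong (image_mset \<phi> x) (image_mset \<phi> y) \<longleftrightarrow> def_cong x y"
    if "set_mset x \<subseteq> atoms T" "set_mset y \<subseteq> atoms T" for x y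
    using that sum_D inj sum_mset_image_additive[of \<phi>, OF additive]
    unfolding def_cong_def by (metis inj_on_eq_iff)
qed

end

section \<open>Splitting a coordinate\<close>

definition merge_coord :: "'i \<Rightarrow> 'i \<Rightarrow> ('i \<Rightarrow> nat) \<Rightarrow> ('i \<Rightarrow> nat)" where
  "merge_coord j j' \<beta> = \<beta>(j := \<beta> j + \<beta> j', j' := 0)"

lemma merge_coord_add: "merge_coord j j' (x + y) = merge_coord j j' x + merge_coord j j' y"
  by (auto simp: merge_coord_def fun_eq_iff)

lemma merge_coord_sum_mset:
  "sum_mset (image_mset (merge_coord j j') X) = merge_coord j j' (sum_mset X)"
  by (rule sum_mset_image_additive) (rule merge_coord_add)

lemma merge_coord_eq_0_iff:
  assumes "j \<noteq> j'"
  shows "merge_coord j j' x = 0 \<longleftrightarrow> x = 0"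
proof
  assume merged: "merge_coord j j' x = 0"
  show "x = 0"
  proof
    fix i
    have "merge_coord j j' x i = 0" "merge_coord j j' x j = 0" using merged by simp_all
    then show "x i = 0 i" using assms by (auto simp: merge_coord_def split: if_splits)
  qed
qed (simp add: merge_coord_def fun_eq_iff)

lemma merge_coord_inj:
  assumes "j \<noteq> j'" and "merge_coord j j' \<beta> = merge_coord j j' \<gamma>" and "\<beta> j = \<gamma> j"
  shows "\<beta> = \<gamma>"
proof
  fix i
  have "merge_coord j j' \<beta> i = merge_coord j j' \<gamma> i" "merge_coord j j' \<beta> j = merge_coord j j' \<gamma> j"
    using assms(2) by simp_all
  then show "\<beta> i = \<gamma> i" using assms(1,3) by (auto simp: merge_coord_def split: if_splits)
qed

lemma merge_coord_eq_plusD: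
  assumes "j \<noteq> j'" and merged: "merge_coord j j' \<beta> = x + y" and "x j' = 0" and "y j' = 0"
  shows "\<exists>b c. \<beta> = b + c \<and> merge_coord j j' b = x \<and> merge_coord j j' c = y"
proof -
  define b where "b = x(j := min (x j) (\<beta> j), j' := x j - min (x j) (\<beta> j))"
  have at_j: "\<beta> j + \<beta> j' = x j + y j" using fun_cong[OF merged, of j] assms(1)
    by (simp add: merge_coord_def)
  have elsewhere: "\<beta> i = x i + y i" if "i \<noteq> j" "i \<noteq> j'" for i
    using fun_cong[OF merged, of i] that by (simp add: merge_coord_def)
  have "b \<le> \<beta>" using at_j elsewhere assms(1) by (auto simp: le_fun_def b_def)
  then have "\<beta> = b + (\<beta> - b)" by (simp add: le_fun_def fun_eq_iff)
  moreover have "merge_coord j j' b = x"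
    using assms(1,3) by (auto simp: merge_coord_def b_def fun_eq_iff)
  moreover have "merge_coord j j' (\<beta> - b) = y"
    using assms(1,4) at_j elsewhere by (auto simp: merge_coord_def b_def fun_eq_iff)
  ultimately show ?thesis by blast
qed

lemma sum_mset_apply_eq_0:
  "(\<And>\<delta>. \<delta> \<in># X \<Longrightarrow> \<delta> i = 0) \<Longrightarrow> sum_mset X i = (0::nat)"
  by (induction X) auto

lemma finite_ex_max_image:
  fixes f :: "'a \<Rightarrow> 'b::linorder"
  assumes "finite A" and "A \<noteq> {}"
  shows "\<exists>x\<in>A. \<forall>y\<in>A. f y \<le> f x"
proof -
  have "Max (f ` A) \<in> f ` A" using assms by simp
  then obtain x where "x \<in> A" "f x = Max (f ` A)" by auto
  moreover have "f y \<le> Max (f ` A)" if "y \<in> A" for y using assms(1) that by simp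
  ultimately show ?thesis by metis
qed

locale coordinate_merge =
  fixes T :: "('i \<Rightarrow> nat) set" and j j' :: 'i and rank :: "('i \<Rightarrow> nat) \<Rightarrow> nat"
  assumes distinct_coords: "j \<noteq> j'" and vanishes: "\<And>\<alpha>. \<alpha> \<in> T \<Longrightarrow> \<alpha> j' = 0"
    and inj_rank: "inj_on rank (atoms T)"
begin

abbreviation M :: "('i \<Rightarrow> nat) \<Rightarrow> ('i \<Rightarrow> nat)" where
  "M \<equiv> merge_coord j j'"

definition T' :: "('i \<Rightarrow> nat) set" where
  "T' = {\<beta>. M \<beta> \<in> T}"

lemma atoms_T'_iff: "\<beta> \<in> atoms T' \<longleftrightarrow> M \<beta> \<in> atoms T"
proof
  assume \<beta>: "\<beta> \<in> atoms T'"
  have "x = 0 \<or> y = 0" if xy: "x \<in> T" "y \<in> T" "M \<beta> = x + y" for x y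
  proof -
    obtain b c where "\<beta> = b + c" "M b = x" "M c = y"
      using merge_coord_eq_plusD[OF distinct_coords xy(3) vanishes[OF xy(1)] vanishes[OF xy(2)]] by blast
    then show ?thesis
      using \<beta> xy(1,2) merge_coord_eq_0_iff[OF distinct_coords]
      by (auto simp: atoms_def T'_def)
  qed
  then show "M \<beta> \<in> atoms T"
    using \<beta> merge_coord_eq_0_iff[OF distinct_coords] by (auto simp: atoms_def T'_def)
next
  assume M\<beta>: "M \<beta> \<in> atoms T"
  have "b = 0 \<or> c = 0" if "b \<in> T'" "c \<in> T'" "\<beta> = b + c" for b c
    using M\<beta> that merge_coord_add[of j j' b c] merge_coord_eq_0_iff[OF distinct_coords]
    by (auto simp: atoms_def T'_def)
  then show "\<beta> \<in> atoms T'"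
    using M\<beta> merge_coord_eq_0_iff[OF distinct_coords] by (auto simp: atoms_def T'_def)
qed

lemma finite_atoms_T':
  assumes "finite (atoms T)"
  shows "finite (atoms T')"
proof -
  have "atoms T' \<subseteq> (\<lambda>(a, t). a(j := t, j' := a j - t)) ` (SIGMA a:atoms T. {..a j})"
  proof
    fix \<beta> assume "\<beta> \<in> atoms T'"
    moreover have "\<beta> = (M \<beta>)(j := \<beta> j, j' := M \<beta> j - \<beta> j)"
      using distinct_coords by (auto simp: merge_coord_def fun_eq_iff)
    moreover have "\<beta> j \<le> M \<beta> j" using distinct_coords by (simp add: merge_coord_def)
    ultimately show "\<beta> \<in> (\<lambda>(a, t). a(j := t, j' := a j - t)) ` (SIGMA a:atoms T. {..a j})"
      using atoms_T'_iff by (intro image_eqI[of _ _ "(M \<beta>, \<beta> j)"]) auto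
  qed
  moreover have "finite (SIGMA a:atoms T. {..a j})" using assms by simp
  ultimately show ?thesis by (meson finite_imageI finite_subset)
qed

lemma atoms_vanish: "\<alpha> \<in> atoms T \<Longrightarrow> \<alpha> j' = 0"
  using vanishes by (simp add: atoms_def)

lemma lift_factorization:
  assumes "set_mset y \<subseteq> atoms T" and "M \<beta> = sum_mset y"
  shows "\<exists>y'. set_mset y' \<subseteq> atoms T' \<and> image_mset M y' = y \<and> sum_mset y' = \<beta>"
  using assms
proof (induction y arbitrary: \<beta>)
  case empty
  then have "\<beta> = 0" using merge_coord_eq_0_iff[OF distinct_coords] by (metis sum_mset.empty)
  then show ?case by (intro exI[of _ "{#}"]) simp
next
  case (add a y)
  have a: "a \<in> atoms T" and y: "set_mset y \<subseteq> atoms T" using add.prems(1) by auto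
  have "a j' = 0" using a by (rule atoms_vanish)
  moreover have "sum_mset y j' = 0" using y atoms_vanish by (intro sum_mset_apply_eq_0) auto
  moreover have "M \<beta> = a + sum_mset y" using add.prems(2) by (simp only: sum_mset.add_mset)
  ultimately obtain b c where bc: "\<beta> = b + c" "M b = a" "M c = sum_mset y"
    using merge_coord_eq_plusD[OF distinct_coords] by blast
  obtain y' where "set_mset y' \<subseteq> atoms T'" "image_mset M y' = y" "sum_mset y' = c"
    using add.IH[OF y bc(3)] by blast
  moreover have "b \<in> atoms T'" using bc(2) a atoms_T'_iff by simp
  ultimately show ?case using bc(1,2) by (intro exI[of _ "add_mset b y'"]) auto
qed

definition key :: "('i \<Rightarrow> nat) \<Rightarrow> nat \<times> nat" where
  "key \<beta> = (rank (M \<beta>), \<beta> j)"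

lemma key_le_imp_rank_le: "key \<delta> \<le> key \<gamma> \<Longrightarrow> rank (M \<delta>) \<le> rank (M \<gamma>)"
  by (auto simp: key_def)

lemma inj_on_key: "inj_on key (atoms T')"
proof (rule inj_onI)
  fix \<beta> \<gamma> assume \<beta>: "\<beta> \<in> atoms T'" and \<gamma>: "\<gamma> \<in> atoms T'" and "key \<beta> = key \<gamma>"
  then have "rank (M \<beta>) = rank (M \<gamma>)" and "\<beta> j = \<gamma> j" by (simp_all add: key_def)
  moreover have "M \<beta> \<in> atoms T" "M \<gamma> \<in> atoms T" using \<beta> \<gamma> atoms_T'_iff by auto
  ultimately show "\<beta> = \<gamma>"
    using inj_rank merge_coord_inj[OF distinct_coords] by (metis inj_on_eq_iff)
qed

definition exchange_free :: "('i \<Rightarrow> nat) multiset \<Rightarrow> bool" where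
  "exchange_free z \<longleftrightarrow> (\<forall>\<beta> \<gamma>. {#\<beta>, \<gamma>#} \<subseteq># z \<longrightarrow> key \<gamma> \<le> key \<beta> \<longrightarrow> \<beta> j' = 0 \<or> \<gamma> j = 0)"

lemma exchange_free_subset: "exchange_free z \<Longrightarrow> z' \<subseteq># z \<Longrightarrow> exchange_free z'"
  unfolding exchange_free_def by (meson subset_mset.order_trans)

lemma exchange:
  assumes \<beta>: "\<beta> \<in> atoms T'" and \<gamma>: "\<gamma> \<in> atoms T'" and "key \<gamma> \<le> key \<beta>"
    and "\<beta> j' \<noteq> 0" and "\<gamma> j \<noteq> 0"
  obtains \<beta>' \<gamma>' where "\<beta>' \<in> atoms T'" "\<gamma>' \<in> atoms T'" "M \<beta>' = M \<beta>" "M \<gamma>' = M \<gamma>"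
    "\<beta>' + \<gamma>' = \<beta> + \<gamma>" "image_mset key {#\<beta>, \<gamma>#} < image_mset key {#\<beta>', \<gamma>'#}"
proof -
  define \<beta>' where "\<beta>' = \<beta>(j := \<beta> j + 1, j' := \<beta> j' - 1)"
  define \<gamma>' where "\<gamma>' = \<gamma>(j := \<gamma> j - 1, j' := \<gamma> j' + 1)"
  have M\<beta>': "M \<beta>' = M \<beta>" using distinct_coords \<open>\<beta> j' \<noteq> 0\<close>
    by (auto simp: \<beta>'_def merge_coord_def fun_eq_iff)
  have M\<gamma>': "M \<gamma>' = M \<gamma>" using distinct_coords \<open>\<gamma> j \<noteq> 0\<close>
    by (auto simp: \<gamma>'_def merge_coord_def fun_eq_iff)
  have "\<beta>' + \<gamma>' = \<beta> + \<gamma>" using distinct_coords \<open>\<beta> j' \<noteq> 0\<close> \<open>\<gamma> j \<noteq> 0\<close>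
    by (auto simp: \<beta>'_def \<gamma>'_def fun_eq_iff)
  moreover have "key \<beta> < key \<beta>'" using M\<beta>' distinct_coords by (simp add: key_def \<beta>'_def)
  \<comment> \<open>so the key of \<beta>' exceeds both keys of the old pair\<close>
  then have "image_mset key {#\<beta>, \<gamma>#} < image_mset key {#\<beta>', \<gamma>'#}"
    using \<open>key \<gamma> \<le> key \<beta>\<close> by (intro ex_gt_imp_less_multiset exI[of _ "key \<beta>'"]) auto
  moreover have "\<beta>' \<in> atoms T'" "\<gamma>' \<in> atoms T'" using \<beta> \<gamma> M\<beta>' M\<gamma>' atoms_T'_iff by auto
  ultimately show thesis using that M\<beta>' M\<gamma>' by blast
qed

lemma exchange_free_coord:
  assumes free: "exchange_free z" and "\<beta> \<in># z" and top: "\<forall>\<delta>\<in>#z. key \<delta> \<le> key \<beta>"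
  shows "\<beta> j = min (M \<beta> j) (sum_mset z j)"
proof -
  have sum_z: "sum_mset z j = \<beta> j + sum_mset (z - {#\<beta>#}) j"
    using \<open>\<beta> \<in># z\<close> by (simp add: sum_mset.remove)
  have M_j: "M \<beta> j = \<beta> j + \<beta> j'" using distinct_coords by (simp add: merge_coord_def)
  show ?thesis
  proof (cases "\<beta> j' = 0")
    case True
    then show ?thesis using sum_z M_j by simp
  next
    case False
    have "\<delta> j = 0" if "\<delta> \<in># z - {#\<beta>#}" for \<delta>
    proof -
      have "{#\<beta>, \<delta>#} \<subseteq># z"
        using \<open>\<beta> \<in># z\<close> that by (metis insert_DiffM mset_subset_eq_add_mset_cancel single_subset_iff)
      moreover have "key \<delta> \<le> key \<beta>" using top that by (meson in_diffD)
      ultimately show ?thesis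
        using free[unfolded exchange_free_def, rule_format, of \<beta> \<delta>] False by blast
    qed
    then have "sum_mset (z - {#\<beta>#}) j = 0" by (rule sum_mset_apply_eq_0)
    then show ?thesis using sum_z M_j by simp
  qed
qed

lemma exchange_free_top_eq:
  assumes z: "set_mset z \<subseteq> atoms T'" "exchange_free z"
    and w: "set_mset w \<subseteq> atoms T'" "exchange_free w"
    and same_image: "image_mset M z = image_mset M w" and "sum_mset z j = sum_mset w j"
    and \<beta>: "\<beta> \<in># z" "\<forall>\<delta>\<in>#z. key \<delta> \<le> key \<beta>"
    and \<gamma>: "\<gamma> \<in># w" "\<forall>\<delta>\<in>#w. key \<delta> \<le> key \<gamma>"
  shows "\<beta> = \<gamma>"
proof -
  have "M \<beta> \<in># image_mset M w" using \<beta>(1) same_image[symmetric] by simp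
  then obtain \<delta> where "\<delta> \<in># w" "M \<delta> = M \<beta>" by auto
  then have "rank (M \<beta>) \<le> rank (M \<gamma>)" using \<gamma>(2) key_le_imp_rank_le by metis
  moreover have "M \<gamma> \<in># image_mset M z" using \<gamma>(1) same_image by simp
  then obtain \<delta>' where "\<delta>' \<in># z" "M \<delta>' = M \<gamma>" by auto
  then have "rank (M \<gamma>) \<le> rank (M \<beta>)" using \<beta>(2) key_le_imp_rank_le by metis
  moreover have "M \<beta> \<in> atoms T" "M \<gamma> \<in> atoms T"
    using \<beta>(1) \<gamma>(1) z(1) w(1) atoms_T'_iff by auto
  ultimately have M_eq: "M \<beta> = M \<gamma>" using inj_rank by (meson inj_on_eq_iff le_antisym)
  then have "\<beta> j = \<gamma> j"
    using exchange_free_coord[OF z(2) \<beta>] exchange_free_coord[OF w(2) \<gamma>] \<open>sum_mset z j = sum_mset w j\<close>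
    by simp
  then show "\<beta> = \<gamma>" using merge_coord_inj[OF distinct_coords M_eq] by blast
qed

lemma exchange_free_unique:
  assumes "set_mset z \<subseteq> atoms T'" "set_mset w \<subseteq> atoms T'" "exchange_free z" "exchange_free w"
    and "image_mset M z = image_mset M w" and "sum_mset z j = sum_mset w j"
  shows "z = w"
  using assms
proof (induction "size z" arbitrary: z w)
  case 0
  then show ?case by (metis image_mset_is_empty_iff size_eq_0_iff_empty)
next
  case (Suc n)
  then have "z \<noteq> {#}" "w \<noteq> {#}" by auto
  then obtain \<beta> \<gamma> where \<beta>: "\<beta> \<in># z" "\<forall>\<delta>\<in>#z. key \<delta> \<le> key \<beta>"
    and \<gamma>: "\<gamma> \<in># w" "\<forall>\<delta>\<in>#w. key \<delta> \<le> key \<gamma>"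
    using finite_ex_max_image[of "set_mset z" key] finite_ex_max_image[of "set_mset w" key] by auto
  have "\<beta> = \<gamma>" using exchange_free_top_eq[OF Suc.prems(1,3,2,4-6) \<beta> \<gamma>] .
  have "z - {#\<beta>#} = w - {#\<beta>#}"
  proof (rule Suc.hyps)
    show "n = size (z - {#\<beta>#})" using Suc.hyps(2) \<beta>(1) by (simp add: size_Diff_singleton)
    show "set_mset (z - {#\<beta>#}) \<subseteq> atoms T'" "set_mset (w - {#\<beta>#}) \<subseteq> atoms T'"
      using Suc.prems(1,2) by (meson in_diffD subset_iff)+
    show "exchange_free (z - {#\<beta>#})" "exchange_free (w - {#\<beta>#})"
      using exchange_free_subset[OF Suc.prems(3)] exchange_free_subset[OF Suc.prems(4)] by simp_all
    show "image_mset M (z - {#\<beta>#}) = image_mset M (w - {#\<beta>#})"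
      using Suc.prems(5) \<beta>(1) \<gamma>(1) \<open>\<beta> = \<gamma>\<close> by (simp add: image_mset_Diff)
    have "sum_mset z = \<beta> + sum_mset (z - {#\<beta>#})" "sum_mset w = \<beta> + sum_mset (w - {#\<beta>#})"
      using \<beta>(1) \<gamma>(1) \<open>\<beta> = \<gamma>\<close> by (simp_all add: sum_mset.remove)
    then show "sum_mset (z - {#\<beta>#}) j = sum_mset (w - {#\<beta>#}) j"
      using Suc.prems(6) by (metis plus_fun_apply add_left_cancel)
  qed
  then show "z = w" using \<beta>(1) \<gamma>(1) \<open>\<beta> = \<gamma>\<close> by (metis insert_DiffM)
qed

lemma exchange_free_if_key_maximal:
  assumes v: "set_mset v \<subseteq> atoms T'"
    and maximal: "\<And>v'. set_mset v' \<subseteq> atoms T' \<Longrightarrow> image_mset M v' = image_mset M v \<Longrightarrow>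
      sum_mset v' = sum_mset v \<Longrightarrow> image_mset key v' \<le> image_mset key v"
  shows "exchange_free v"
  unfolding exchange_free_def
proof (intro allI impI, rule ccontr)
  fix \<beta> \<gamma> assume sub: "{#\<beta>, \<gamma>#} \<subseteq># v" and "key \<gamma> \<le> key \<beta>" and "\<not> (\<beta> j' = 0 \<or> \<gamma> j = 0)"
  moreover have "\<beta> \<in> atoms T'" "\<gamma> \<in> atoms T'" using sub v by (auto dest: mset_subset_eqD)
  ultimately obtain \<beta>' \<gamma>' where ex: "\<beta>' \<in> atoms T'" "\<gamma>' \<in> atoms T'" "M \<beta>' = M \<beta>" "M \<gamma>' = M \<gamma>"
    "\<beta>' + \<gamma>' = \<beta> + \<gamma>" "image_mset key {#\<beta>, \<gamma>#} < image_mset key {#\<beta>', \<gamma>'#}"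
    using exchange by blast
  define r where "r = v - {#\<beta>, \<gamma>#}"
  have v_eq: "v = r + {#\<beta>, \<gamma>#}"
    unfolding r_def using subset_mset.diff_add[OF sub] by (rule sym)
  define v' where "v' = r + {#\<beta>', \<gamma>'#}"
  have "set_mset v' \<subseteq> atoms T'" using v ex(1,2) by (auto simp: v'_def v_eq)
  moreover have "image_mset M v' = image_mset M v" using ex(3,4) by (simp add: v'_def v_eq)
  moreover have "sum_mset v' = sum_mset v"
    using ex(5) by (simp add: v'_def v_eq add.assoc[symmetric])
  moreover have "image_mset key v < image_mset key v'"
    unfolding v'_def v_eq image_mset_union using ex(6) by (rule add_strict_left_mono)
  ultimately show False using maximal[of v'] by (meson leD)
qed

lemma exchange_free_key_greatest:
  assumes "finite (atoms T)"
    and z: "set_mset z \<subseteq> atoms T'" "exchange_free z"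
    and w: "set_mset w \<subseteq> atoms T'" "image_mset M w = image_mset M z" "sum_mset w = sum_mset z"
    and "w \<noteq> z"
  shows "image_mset key w < image_mset key z"
proof -
  define F where "F = {v. set_mset v \<subseteq> atoms T' \<and> image_mset M v = image_mset M z \<and> sum_mset v = sum_mset z}"
  have "F \<subseteq> multisets_of_size (atoms T') (size z)"
    by (auto simp: F_def multisets_of_size_def) (metis size_image_mset)
  then have "finite F"
    using finite_multisets_of_size[OF finite_atoms_T'[OF assms(1)]] by (rule finite_subset)
  moreover have "z \<in> F" using z by (simp add: F_def)
  ultimately obtain v where v: "v \<in> F" and max: "\<forall>v'\<in>F. image_mset key v' \<le> image_mset key v"
    using finite_ex_max_image[of F "image_mset key"] by blast
  have "exchange_free v"
    using v max by (intro exchange_free_if_key_maximal) (auto simp: F_def)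
  then have "v = z"
    using exchange_free_unique[of v z] v z by (auto simp: F_def)
  then have "image_mset key w \<le> image_mset key z" using max w by (simp add: F_def)
  moreover have "image_mset key w \<noteq> image_mset key z"
    using image_mset_inj_on_eq[OF inj_on_key] w z \<open>w \<noteq> z\<close> by blast
  ultimately show ?thesis by simp
qed

text \<open>Within a fibre of M the larger multiset of keys comes first, so that normal forms are the
  key-maximal, i.e. exchange-free, monomials.\<close>
definition merged_order ::
    "(('i \<Rightarrow> nat) multiset \<Rightarrow> ('i \<Rightarrow> nat) multiset \<Rightarrow> bool) \<Rightarrow>
     ('i \<Rightarrow> nat) multiset \<Rightarrow> ('i \<Rightarrow> nat) multiset \<Rightarrow> bool" where
  "merged_order lt x y \<longleftrightarrow> lt (image_mset M x) (image_mset M y) \<or>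
     image_mset M x = image_mset M y \<and> image_mset key y < image_mset key x"

lemma admissible_merged_order:
  assumes "admissible_order (atoms T) lt"
  shows "admissible_order (atoms T') (merged_order lt)"
  unfolding merged_order_def[abs_def]
proof (rule admissible_order_refine[OF assms, where tb = "\<lambda>x y. image_mset key y < image_mset key x"])
  show "M a \<in> atoms T" if "a \<in> atoms T'" for a using that atoms_T'_iff by simp
  show "image_mset key y < image_mset key x \<or> image_mset key x < image_mset key y"
    if "set_mset x \<subseteq> atoms T'" "set_mset y \<subseteq> atoms T'" "x \<noteq> y" for x y
    using that image_mset_inj_on_eq[OF inj_on_key] neq_iff by metis
qed (auto simp: add_strict_right_mono)

lemma quadratic_normal_imp_exchange_free:
  assumes z: "set_mset z \<subseteq> atoms T'" and normal: "quadratic_normal (atoms T') (merged_order lt) z"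
  shows "exchange_free z"
  unfolding exchange_free_def
proof (intro allI impI, rule ccontr)
  fix \<beta> \<gamma> assume sub: "{#\<beta>, \<gamma>#} \<subseteq># z" and "key \<gamma> \<le> key \<beta>" and "\<not> (\<beta> j' = 0 \<or> \<gamma> j = 0)"
  moreover have "\<beta> \<in> atoms T'" "\<gamma> \<in> atoms T'" using sub z by (auto dest: mset_subset_eqD)
  ultimately obtain \<beta>' \<gamma>' where ex: "\<beta>' \<in> atoms T'" "\<gamma>' \<in> atoms T'" "M \<beta>' = M \<beta>" "M \<gamma>' = M \<gamma>"
    "\<beta>' + \<gamma>' = \<beta> + \<gamma>" "image_mset key {#\<beta>, \<gamma>#} < image_mset key {#\<beta>', \<gamma>'#}"
    using exchange by blast
  then have "def_cong {#\<beta>, \<gamma>#} {#\<beta>', \<gamma>'#}" and "merged_order lt {#\<beta>', \<gamma>'#} {#\<beta>, \<gamma>#}"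
    by (simp_all add: def_cong_def merged_order_def add.commute)
  then show False
    using normal sub ex(1,2) unfolding quadratic_normal_def by fastforce
qed

lemma quadratic_normal_imp_image_normal:
  assumes \<Lambda>: "\<forall>(x, y) \<in> \<Lambda>. set_mset y \<subseteq> atoms T \<and> def_cong x y \<and> lt y x \<and> size x \<le> 2 \<and> size y \<le> 2"
    and normal: "quadratic_normal (atoms T') (merged_order lt) z"
  shows "\<forall>(x, y) \<in> \<Lambda>. \<not> x \<subseteq># image_mset M z"
proof (clarify)
  fix x y assume xy: "(x, y) \<in> \<Lambda>" and "x \<subseteq># image_mset M z"
  then obtain x' where x': "x' \<subseteq># z" "image_mset M x' = x"
    using image_mset_eq_plusD[of M z x "image_mset M z - x"]
    by (metis mset_subset_eq_exists_conv subset_mset.add_diff_inverse)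
  have y: "set_mset y \<subseteq> atoms T" "def_cong x y" "lt y x" "size x \<le> 2" "size y \<le> 2"
    using xy \<Lambda> by auto
  then have "M (sum_mset x') = sum_mset y"
    using x'(2) merge_coord_sum_mset[of j j' x'] by (simp add: def_cong_def)
  then obtain y' where y': "set_mset y' \<subseteq> atoms T'" "image_mset M y' = y" "sum_mset y' = sum_mset x'"
    using lift_factorization[OF y(1)] by metis
  have "def_cong x' y'" using y'(3) by (simp add: def_cong_def)
  moreover have "merged_order lt y' x'" using y(3) x'(2) y'(2) by (simp add: merged_order_def)
  moreover have "size x' \<le> 2" "size y' \<le> 2" using x'(2) y'(2) y(4,5) by auto
  ultimately show False
    using normal x'(1) y'(1) unfolding quadratic_normal_def by blast
qed

theorem has_quadratic_groebner_system_T':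
  assumes "finite (atoms T)" and "has_quadratic_groebner_system T"
  shows "has_quadratic_groebner_system T'"
proof -
  obtain lt \<Lambda> where adm: "admissible_order (atoms T) lt"
    and \<Lambda>: "\<forall>(x, y) \<in> \<Lambda>. set_mset x \<subseteq> atoms T \<and> set_mset y \<subseteq> atoms T \<and>
      def_cong x y \<and> lt y x \<and> size x \<le> 2 \<and> size y \<le> 2"
    and groebner: "\<forall>z. set_mset z \<subseteq> atoms T \<longrightarrow> (\<forall>(x, y) \<in> \<Lambda>. \<not> x \<subseteq># z) \<longrightarrow>
      (\<forall>w. set_mset w \<subseteq> atoms T \<longrightarrow> def_cong w z \<longrightarrow> w \<noteq> z \<longrightarrow> lt z w)"
    using assms(2) unfolding has_quadratic_groebner_system_def by blast
  have \<Lambda>': "\<forall>(x, y) \<in> \<Lambda>. set_mset y \<subseteq> atoms T \<and> def_cong x y \<and> lt y x \<and> size x \<le> 2 \<and> size y \<le> 2"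
    using \<Lambda> by auto
  have M_into: "set_mset (image_mset M x) \<subseteq> atoms T" if "set_mset x \<subseteq> atoms T'" for x
    using that atoms_T'_iff by auto
  show ?thesis
  proof (rule has_quadratic_groebner_systemI[where lt = "merged_order lt"])
    show "finite (atoms T')" using finite_atoms_T'[OF assms(1)] .
    show "admissible_order (atoms T') (merged_order lt)" using admissible_merged_order[OF adm] .
    fix z w assume z: "set_mset z \<subseteq> atoms T'" and w: "set_mset w \<subseteq> atoms T'"
      and normal: "quadratic_normal (atoms T') (merged_order lt) z"
      and "def_cong w z" and "w \<noteq> z"
    show "merged_order lt z w"
    proof (cases "image_mset M w = image_mset M z")
      case True
      have "exchange_free z" using quadratic_normal_imp_exchange_free[OF z normal] .
      moreover have "sum_mset w = sum_mset z" using \<open>def_cong w z\<close> by (simp add: def_cong_def)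
      ultimately have "image_mset key w < image_mset key z"
        using exchange_free_key_greatest[OF assms(1) z _ w True _ \<open>w \<noteq> z\<close>] by blast
      then show ?thesis using True by (simp add: merged_order_def)
    next
      case False
      have "\<forall>(x, y) \<in> \<Lambda>. \<not> x \<subseteq># image_mset M z"
        using quadratic_normal_imp_image_normal[OF \<Lambda>' normal] .
      moreover have "def_cong (image_mset M w) (image_mset M z)"
        using \<open>def_cong w z\<close> by (simp add: def_cong_def merge_coord_sum_mset)
      ultimately have "lt (image_mset M z) (image_mset M w)"
        using groebner[rule_format, OF M_into[OF z] _ M_into[OF w]] False by blast
      then show ?thesis by (simp add: merged_order_def)
    qed
  qed
qed

end

theorem has_quadratic_groebner_system_merge_coord:
  assumes "has_quadratic_groebner_system T" and "finite (atoms T)"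
    and "j \<noteq> j'" and "\<And>\<alpha>. \<alpha> \<in> T \<Longrightarrow> \<alpha> j' = 0"
  shows "has_quadratic_groebner_system {\<beta>. merge_coord j j' \<beta> \<in> T}"
proof -
  obtain rank :: "_ \<Rightarrow> nat" where "inj_on rank (atoms T)"
    using finite_imp_inj_to_nat_seg[OF assms(2)] by blast
  then interpret coordinate_merge T j j' rank
    using assms(3,4) by unfold_locales
  show ?thesis using has_quadratic_groebner_system_T'[OF assms(2,1)] by (simp add: T'_def)
qed

section \<open>Monoids of product-one sequences\<close>

lemma BG_diff:
  fixes G (structure)
  assumes "comm_group G" and "g ` K \<subseteq> carrier G"
    and a: "a \<in> BG G g K" and b: "b \<in> BG G g K" and "a \<le> b"
  shows "b - a \<in> BG G g K"
proof -
  interpret comm_group G by fact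
  have g: "\<And>i. i \<in> K \<Longrightarrow> g i \<in> carrier G" using assms(2) by auto
  have "\<one> = finprod G (\<lambda>i. g i [^] b i) K" using b by (simp add: BG_def)
  also have "\<dots> = finprod G (\<lambda>i. g i [^] a i \<otimes> g i [^] (b - a) i) K"
    using \<open>a \<le> b\<close> g by (intro finprod_cong') (auto simp: le_fun_def nat_pow_mult)
  also have "\<dots> = finprod G (\<lambda>i. g i [^] a i) K \<otimes> finprod G (\<lambda>i. g i [^] (b - a) i) K"
    using g by (intro finprod_multf) auto
  also have "\<dots> = finprod G (\<lambda>i. g i [^] (b - a) i) K"
    using a g by (simp add: BG_def Pi_def)
  finally show ?thesis using b by (simp add: BG_def)
qed

lemma finite_atoms_BG:
  fixes G (structure)
  assumes "comm_group G" and "finite K" and "g ` K \<subseteq> carrier G"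
  shows "finite (atoms (BG G g K))"
proof (rule finite_antichain_of_finite_support[OF \<open>finite K\<close>])
  show "\<And>x s. x \<in> atoms (BG G g K) \<Longrightarrow> s \<notin> K \<Longrightarrow> x s = 0"
    by (simp add: atoms_def BG_def)
  show "\<And>x y. x \<in> atoms (BG G g K) \<Longrightarrow> y \<in> atoms (BG G g K) \<Longrightarrow> x \<le> y \<Longrightarrow> x = y"
    using atoms_antichain BG_diff[OF assms(1,3)] by blast
qed

lemma BG_reindex:
  fixes G (structure)
  assumes "comm_group G" and g: "g ` K \<subseteq> carrier G" and "inj_on g K"
  shows "BG G g K = (\<lambda>\<alpha> i. if i \<in> K then \<alpha> (g i) else 0) ` BG G id (g ` K)"
proof -
  interpret comm_group G by fact
  have reindex: "finprod G (\<lambda>s. id s [^] \<alpha> s) (g ` K) = finprod G (\<lambda>i. g i [^] \<alpha> (g i)) K"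
    for \<alpha> :: "'a \<Rightarrow> nat"
    using finprod_reindex[of "\<lambda>s. s [^] \<alpha> s" g K] g \<open>inj_on g K\<close> by auto
  show ?thesis
  proof (intro equalityI subsetI)
    fix \<beta> assume \<beta>: "\<beta> \<in> BG G g K"
    define \<alpha> where "\<alpha> s = (if s \<in> g ` K then \<beta> (inv_into K g s) else 0)" for s
    have \<alpha>_g: "\<alpha> (g i) = \<beta> i" if "i \<in> K" for i using that \<open>inj_on g K\<close> by (simp add: \<alpha>_def)
    have "finprod G (\<lambda>s. id s [^] \<alpha> s) (g ` K) = finprod G (\<lambda>i. g i [^] \<beta> i) K"
      unfolding reindex using g \<alpha>_g by (intro finprod_cong') auto
    then have "\<alpha> \<in> BG G id (g ` K)" using \<beta> by (simp add: BG_def \<alpha>_def)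
    moreover have "\<beta> = (\<lambda>i. if i \<in> K then \<alpha> (g i) else 0)"
      using \<beta> \<alpha>_g by (auto simp: BG_def fun_eq_iff)
    ultimately show "\<beta> \<in> (\<lambda>\<alpha> i. if i \<in> K then \<alpha> (g i) else 0) ` BG G id (g ` K)" by blast
  next
    fix \<beta> assume "\<beta> \<in> (\<lambda>\<alpha> i. if i \<in> K then \<alpha> (g i) else 0) ` BG G id (g ` K)"
    then obtain \<alpha> where \<alpha>: "\<alpha> \<in> BG G id (g ` K)" and \<beta>: "\<beta> = (\<lambda>i. if i \<in> K then \<alpha> (g i) else 0)"
      by blast
    have "finprod G (\<lambda>i. g i [^] \<beta> i) K = finprod G (\<lambda>i. g i [^] \<alpha> (g i)) K"
      unfolding \<beta> using g by (intro finprod_cong') auto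
    then show "\<beta> \<in> BG G g K" using \<alpha> reindex by (simp add: BG_def \<beta>)
  qed
qed

lemma BG_insert_duplicate:
  fixes G (structure)
  assumes "comm_group G" and "finite K" and g: "g ` insert x K \<subseteq> carrier G"
    and "r \<in> K" and "x \<notin> K" and "g x = g r"
  shows "BG G g (insert x K) = {\<beta>. merge_coord r x \<beta> \<in> BG G g K}"
proof -
  interpret comm_group G by fact
  have gK: "\<And>i. i \<in> K \<Longrightarrow> g i \<in> carrier G" and gx: "g x \<in> carrier G" using g by auto
  have "finprod G (\<lambda>i. g i [^] merge_coord r x \<beta> i) K = g x [^] \<beta> x \<otimes> finprod G (\<lambda>i. g i [^] \<beta> i) K"
    for \<beta> :: "_ \<Rightarrow> nat"
  proof -
    have "finprod G (\<lambda>i. g i [^] merge_coord r x \<beta> i) K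
        = finprod G (\<lambda>i. g i [^] \<beta> i \<otimes> (if r = i then g i [^] \<beta> x else \<one>)) K"
      using gK \<open>x \<notin> K\<close> by (intro finprod_cong') (auto simp: merge_coord_def nat_pow_mult)
    also have "\<dots> = finprod G (\<lambda>i. g i [^] \<beta> i) K \<otimes> g r [^] \<beta> x"
      using gK \<open>r \<in> K\<close> \<open>finite K\<close> by (simp add: finprod_multf finprod_singleton Pi_def)
    finally show ?thesis using gK \<open>r \<in> K\<close> \<open>g x = g r\<close> by (simp add: m_comm)
  qed
  moreover have "finprod G (\<lambda>i. g i [^] \<beta> i) (insert x K) = g x [^] \<beta> x \<otimes> finprod G (\<lambda>i. g i [^] \<beta> i) K"
    for \<beta> :: "_ \<Rightarrow> nat"
    using \<open>finite K\<close> \<open>x \<notin> K\<close> gK gx by (intro finprod_insert) auto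
  moreover have "(\<forall>i. i \<notin> insert x K \<longrightarrow> \<beta> i = 0) \<longleftrightarrow> (\<forall>i. i \<notin> K \<longrightarrow> merge_coord r x \<beta> i = 0)" for \<beta>
    using \<open>r \<in> K\<close> \<open>x \<notin> K\<close> by (auto simp: merge_coord_def)
  ultimately show ?thesis by (auto simp: BG_def)
qed

lemma has_quadratic_groebner_system_BG_inj:
  fixes G (structure)
  assumes "comm_group G" and "finite K" and "g ` K \<subseteq> carrier G" and "inj_on g K"
    and "has_quadratic_groebner_system (BG G id (g ` K))"
  shows "has_quadratic_groebner_system (BG G g K)"
proof -
  define D where "D = {\<alpha> :: 'a \<Rightarrow> nat. \<forall>s. s \<notin> g ` K \<longrightarrow> \<alpha> s = 0}"
  define \<phi> where "\<phi> \<alpha> i = (if i \<in> K then \<alpha> (g i) else 0)" for \<alpha> :: "'a \<Rightarrow> nat" and i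
  have "inj_on \<phi> D"
  proof (rule inj_onI)
    fix \<alpha> \<alpha>' assume "\<alpha> \<in> D" "\<alpha>' \<in> D" "\<phi> \<alpha> = \<phi> \<alpha>'"
    show "\<alpha> = \<alpha>'"
    proof
      fix s
      show "\<alpha> s = \<alpha>' s"
      proof (cases "s \<in> g ` K")
        case True
        then obtain i where "i \<in> K" "s = g i" by blast
        then show ?thesis using fun_cong[OF \<open>\<phi> \<alpha> = \<phi> \<alpha>'\<close>, of i] by (simp add: \<phi>_def)
      next
        case False
        then show ?thesis using \<open>\<alpha> \<in> D\<close> \<open>\<alpha>' \<in> D\<close> by (simp add: D_def)
      qed
    qed
  qed
  moreover have "finite (atoms (BG G id (g ` K)))"
    using finite_atoms_BG[OF assms(1), of "g ` K" id] assms(2,3) by simp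
  moreover have "BG G id (g ` K) \<subseteq> D" by (auto simp: BG_def D_def)
  ultimately have "has_quadratic_groebner_system (\<phi> ` BG G id (g ` K))"
    using has_quadratic_groebner_system_image[of D \<phi>] assms(5)
    by (auto simp: D_def \<phi>_def fun_eq_iff)
  then show ?thesis using BG_reindex[OF assms(1,3,4)] by (simp add: \<phi>_def[abs_def])
qed

theorem has_quadratic_groebner_system_BG:
  fixes G (structure)
  assumes "comm_group G" and "finite K" and "g ` K \<subseteq> carrier G"
    and "has_quadratic_groebner_system (BG G id (g ` K))"
  shows "has_quadratic_groebner_system (BG G g K)"
  using assms(2-4)
proof (induction K rule: finite_psubset_induct)
  case (psubset K)
  show ?case
  proof (cases "inj_on g K")
    case True
    then show ?thesis
      using has_quadratic_groebner_system_BG_inj assms(1) psubset.hyps psubset.prems by blast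
  next
    case False
    then obtain x r where "x \<in> K" "r \<in> K" "x \<noteq> r" "g x = g r" by (auto simp: inj_on_def)
    define K' where "K' = K - {x}"
    have K: "K = insert x K'" "x \<notin> K'" "r \<in> K'" "finite K'"
      using \<open>x \<in> K\<close> \<open>r \<in> K\<close> \<open>x \<noteq> r\<close> psubset.hyps by (auto simp: K'_def)
    have "g ` K' = g ` K" using K \<open>g x = g r\<close> by auto
    then have "has_quadratic_groebner_system (BG G g K')"
      using psubset.IH[of K'] psubset.prems K by auto
    moreover have "finite (atoms (BG G g K'))"
      using finite_atoms_BG[OF assms(1) \<open>finite K'\<close>] psubset.prems(1) K by auto
    moreover have "\<alpha> x = 0" if "\<alpha> \<in> BG G g K'" for \<alpha> using that K by (simp add: BG_def)
    ultimately have "has_quadratic_groebner_system {\<beta>. merge_coord r x \<beta> \<in> BG G g K'}"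
      using has_quadratic_groebner_system_merge_coord \<open>x \<noteq> r\<close> by metis
    then show ?thesis
      using BG_insert_duplicate[OF assms(1) \<open>finite K'\<close> _ \<open>r \<in> K'\<close> \<open>x \<notin> K'\<close> \<open>g x = g r\<close>]
        psubset.prems(1) K(1) by simp
  qed
qed

theorem corollary5p6:
  fixes G (structure) and g :: "nat \<Rightarrow> 'a" and m :: nat
  assumes "comm_group G"
    and "\<forall>i<m. g i \<in> carrier G"
    and "has_quadratic_groebner_system (BG G id (g ` {..<m}))"
  shows "has_quadratic_groebner_system (BG G g {..<m})"
proof (rule has_quadratic_groebner_system_BG[OF assms(1) finite_lessThan _ assms(3)])
  show "g ` {..<m} \<subseteq> carrier G" using assms(2) by auto
qed

end
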